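(* Let $n\ge 2$ and let \[ T = \begin{pmatrix} 0&0&0&0&1&1&1&1&1&0&0 \\ 0&0&0&0&1&1&1&1&1&1&0 \\ 0&0&0&0&1&1&1&1&0&0&0 \\ 0&0&0&0&1&1&1&1&0&1&0 \\ 1&1&1&1&0&0&0&0&1&0&0 \\ 1&1&1&1&0&0&0&0&1&1&0 \\ 1&1&1&1&0&0&0&0&0&1&0 \\ 1&1&1&1&0&0&0&0&0&0&0 \\ 1&1&0&0&1&1&0&0&0&1&0 \\ 0&1&0&1&0&1&0&1&1&0&0 \\ 0&0&0&0&0&0&0&0&0&0&0 \end{pmatrix}. \] If there exists a simple minimiser in $\mathcal{S}_n$, then there exist non-negative integers $x_1,\dots,x_{11}$ with $x_1+\dots+x_{11}=n$ such that the vertex multiplication $\tilde{T}$ of $T$ by $[x_1,\dots,x_{11}]$ satisfies \[ \lambda_{n-1}(\tilde{T}) - 2\sqrt{n} \le \lambda_{n-1}(S) \quad\text{for all } S \in \mathcal{S}_n. \]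
   Context: $\mathcal{S}_n$ is the set of $n\times n$ real symmetric matrices with all entries in $[0,1]$; $\lambda_k(M)$ is the $k$-th largest eigenvalue of $M$ counted with multiplicity. A simple minimiser is a matrix $M\in\mathcal{S}_n$ with $\lambda_n(M) < \lambda_{n-1}(M)$ such that $\lambda_{n-1}(M)\le\lambda_{n-1}(M')$ for all $M'\in\mathcal{S}_n$. For a $k\times k$ symmetric $0/1$ matrix $T$ with zero diagonal and non-negative integers $x_1,\dots,x_k$, the vertex multiplication of $T$ by $[x_1,\dots,x_k]$ is the $(\sum_i x_i)\times(\sum_i x_i)$ block matrix whose $(i,j)$ block is the $x_i\times x_j$ matrix with every entry equal to $T_{ij}$ (equivalently, the adjacency matrix of the graph obtained from the graph of $T$ by replacing vertex $i$ with an independent set of $x_i$ vertices and each edge $ij$ by a complete bipartite graph between the corresponding sets). *)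

theory Defs
  imports "Jordan_Normal_Form.Jordan_Normal_Form" "HOL-Library.Multiset"
begin

(* Multiset of eigenvalues of a real square matrix, counted with (algebraic) multiplicity:
   the roots of the characteristic polynomial with their orders. For real symmetric
   matrices the characteristic polynomial splits over the reals. *)
definition eig_mset :: "real mat \<Rightarrow> real multiset" where
  "eig_mset A = Abs_multiset (\<lambda>x. order x (char_poly A))"

definition eig_list :: "real mat \<Rightarrow> real list" where
  "eig_list A = rev (sorted_list_of_multiset (eig_mset A))"

definition lam :: "nat \<Rightarrow> real mat \<Rightarrow> real" where
  "lam k A = eig_list A ! (k - 1)"

definition S_set :: "nat \<Rightarrow> real mat set" where
  "S_set n = {M. M \<in> carrier_mat n n \<and> transpose_mat M = M \<and>
                 (\<forall>i<n. \<forall>j<n. 0 \<le> M $$ (i,j) \<and> M $$ (i,j) \<le> 1)}"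

definition simple_minimiser :: "nat \<Rightarrow> real mat \<Rightarrow> bool" where
  "simple_minimiser n M \<longleftrightarrow> M \<in> S_set n \<and> lam n M < lam (n - 1) M \<and>
     (\<forall>M' \<in> S_set n. lam (n - 1) M \<le> lam (n - 1) M')"

definition block_of :: "nat list \<Rightarrow> nat \<Rightarrow> nat" where
  "block_of xs r = (LEAST i. r < sum_list (take (Suc i) xs))"

definition vertex_mult :: "real mat \<Rightarrow> nat list \<Rightarrow> real mat" where
  "vertex_mult T xs = mat (sum_list xs) (sum_list xs)
      (\<lambda>(r, c). T $$ (block_of xs r, block_of xs c))"

definition T11 :: "real mat" where
  "T11 = mat_of_rows_list 11
    [[0,0,0,0,1,1,1,1,1,0,0],
     [0,0,0,0,1,1,1,1,1,1,0],
     [0,0,0,0,1,1,1,1,0,0,0],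
     [0,0,0,0,1,1,1,1,0,1,0],
     [1,1,1,1,0,0,0,0,1,0,0],
     [1,1,1,1,0,0,0,0,1,1,0],
     [1,1,1,1,0,0,0,0,0,1,0],
     [1,1,1,1,0,0,0,0,0,0,0],
     [1,1,0,0,1,1,0,0,0,1,0],
     [0,1,0,1,0,1,0,1,1,0,0],
     [0,0,0,0,0,0,0,0,0,0,0]]"

end

theory Submission
  imports Defs "Jordan_Normal_Form.Schur_Decomposition" "HOL-Combinatorics.List_Permutation"
    "HOL-Analysis.Convex"
begin

text \<open>
  Every \<open>S\<close> in \<open>S_set n\<close> satisfies \<open>lam (n - 1) S \<ge> - n / 3\<close>, and up to an additive constant this
  is attained by the balanced complete tripartite graph, which is a vertex multiplication
  of \<open>T11\<close> since the first, fifth and ninth vertices form a triangle.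

  For the bound, let \<open>x\<close> and \<open>y\<close> be orthonormal eigenvectors for the two smallest
  eigenvalues and \<open>P\<close> the orthogonal projection onto their span. As the entries of \<open>S\<close> lie in
  \<open>[0,1]\<close>, the sum of these eigenvalues is at least half the sum of the numbers \<open>P i j - \<bar>P i j\<bar>\<close>.
  The sum of all \<open>P i j\<close> is nonnegative, and the sum of all \<open>\<bar>P i j\<bar>\<close> is at most \<open>4 n / 3\<close>: this is
  the statement that planes have absolute projection constant \<open>4/3\<close>, in the case of uniform weights.
  It follows by writing \<open>(x i, y i)\<close> in polar form and majorising \<open>\<bar>cos t\<bar>\<close> by
  a trigonometric polynomial in \<open>2 t\<close> that touches it at the multiples of \<open>\<pi> / 3\<close>.
\<close>

section \<open>Absolute entry sums of rank-two projections\<close>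

text \<open>The three coefficients are determined by matching the value at 0 and both value and
  slope at pi/3. In terms of \<open>s\<close>, the absolute value of \<open>cos t\<close>, the
  difference of the two sides then has a double root at 1/2 and a root at 1.\<close>

lemma abs_cos_le:
  fixes t :: real
  shows "\<bar>cos t\<bar> \<le> 2/3 + 7/18 * cos (2 * t) - 1/18 * cos (4 * t)"
proof -
  define s where "s = \<bar>cos t\<bar>"
  have s: "0 \<le> s" "s \<le> 1" "(cos t)\<^sup>2 = s\<^sup>2"
    by (auto simp: s_def)
  have c2: "cos (2 * t) = 2 * s\<^sup>2 - 1"
    using cos_double_cos[of t] s(3) by simp
  have "cos (4 * t) = 2 * (cos (2 * t))\<^sup>2 - 1"
    using cos_double_cos[of "2 * t"] by simp
  then have "2/3 + 7/18 * cos (2 * t) - 1/18 * cos (4 * t) - s = (2 * s - 1)\<^sup>2 * ((1 - s) * (2 + s)) / 9"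
    unfolding c2 by (simp add: power2_eq_square field_simps)
  moreover have "0 \<le> (2 * s - 1)\<^sup>2 * ((1 - s) * (2 + s)) / 9"
    using s by simp
  ultimately show ?thesis
    unfolding s_def by linarith
qed

text \<open>Both sides are the squared modulus of the sum of
  \<open>r i * cis (c * \<phi> i)\<close>. In particular such a double sum is nonnegative.\<close>

lemma sum_sum_mult_cos_diff:
  fixes r \<phi> :: "'a \<Rightarrow> real"
  shows "(\<Sum>i\<in>I. \<Sum>j\<in>I. r i * r j * cos (c * (\<phi> i - \<phi> j)))
       = (\<Sum>i\<in>I. r i * cos (c * \<phi> i))\<^sup>2 + (\<Sum>i\<in>I. r i * sin (c * \<phi> i))\<^sup>2"
proof -
  have "r i * r j * cos (c * (\<phi> i - \<phi> j)) = (r i * cos (c * \<phi> i)) * (r j * cos (c * \<phi> j))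
      + (r i * sin (c * \<phi> i)) * (r j * sin (c * \<phi> j))" for i j
    unfolding right_diff_distrib cos_diff distrib_left by (simp only: mult_ac)
  then show ?thesis
    by (simp only: sum.distrib power2_eq_square sum_product)
qed

text \<open>Two estimates are balanced. Bounding the cosines by 1 gives at most the square of the
  sum \<open>R\<close> of the radii, which is good when \<open>R\<close> is small. The trigonometric
  majorant leaves the second Fourier coefficient \<open>(C, S)\<close> of the radii, which is small
  when the radii are nearly constant, that is, when \<open>R\<close> is close to its maximum
  \<open>2 * m\<close>.\<close>

lemma sum_abs_rank_two_projection_le:
  fixes x y :: "'a \<Rightarrow> real"
  assumes xx: "(\<Sum>i\<in>I. (x i)\<^sup>2) = 1" and yy: "(\<Sum>i\<in>I. (y i)\<^sup>2) = 1"
    and xy: "(\<Sum>i\<in>I. x i * y i) = 0"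
  shows "(\<Sum>i\<in>I. \<Sum>j\<in>I. \<bar>x i * x j + y i * y j\<bar>) \<le> 4/3 * real (card I)"
proof -
  define r where "r i = cmod (Complex (x i) (y i))" for i
  define \<theta> where "\<theta> i = Arg (Complex (x i) (y i))" for i
  have r0: "r i \<ge> 0" for i
    by (simp add: r_def)
  have "Complex (x i) (y i) = rcis (r i) (\<theta> i)" for i
    by (simp add: r_def \<theta>_def rcis_cmod_Arg)
  then have x: "x i = r i * cos (\<theta> i)" and y: "y i = r i * sin (\<theta> i)" for i
    by (simp_all add: complex_eq_iff)
  \<comment> \<open>As the squares of the radii sum to 2, constant radii would all equal
    \<open>1 / m\<close>; thus \<open>1 - m * r i\<close> measures the deviation from this
    case.\<close>
  define m where "m = sqrt (real (card I) / 2)"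
  have m0: "m \<ge> 0" and m2: "real (card I) = 2 * m\<^sup>2"
    by (simp_all add: m_def)
  define R where "R = (\<Sum>i\<in>I. r i)"
  define C where "C = (\<Sum>i\<in>I. r i * cos (2 * \<theta> i))"
  define S where "S = (\<Sum>i\<in>I. r i * sin (2 * \<theta> i))"
  have R0: "R \<ge> 0"
    by (simp add: R_def r0 sum_nonneg)
  have r2: "(r i)\<^sup>2 = (x i)\<^sup>2 + (y i)\<^sup>2" for i
    by (simp add: r_def cmod_power2)
  have rr: "(\<Sum>i\<in>I. (r i)\<^sup>2) = 2"
    using xx yy by (simp add: r2 sum.distrib)
  \<comment> \<open>Orthonormality of \<open>x\<close> and \<open>y\<close> says that the sum of the
    complex squares of \<open>x i + \<i> * y i\<close> vanishes; \<open>c0\<close> and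
    \<open>s0\<close> are its real and imaginary parts.\<close>
  have "(r i)\<^sup>2 * cos (2 * \<theta> i) = (x i)\<^sup>2 - (y i)\<^sup>2" for i
    unfolding x y cos_double power_mult_distrib by (simp only: right_diff_distrib)
  then have c0: "(\<Sum>i\<in>I. (r i)\<^sup>2 * cos (2 * \<theta> i)) = 0"
    using xx yy by (simp add: sum_subtractf)
  have "(r i)\<^sup>2 * sin (2 * \<theta> i) = 2 * (x i * y i)" for i
    by (simp add: x y sin_double power2_eq_square)
  then have s0: "(\<Sum>i\<in>I. (r i)\<^sup>2 * sin (2 * \<theta> i)) = 0"
    using xy by (simp flip: sum_distrib_left)
  have P: "x i * x j + y i * y j = r i * r j * cos (\<theta> i - \<theta> j)" for i j
    by (simp add: x y cos_diff algebra_simps)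
  let ?T = "\<Sum>i\<in>I. \<Sum>j\<in>I. \<bar>x i * x j + y i * y j\<bar>"
  have T1: "?T \<le> R\<^sup>2"
    unfolding R_def power2_eq_square sum_product P
    by (intro sum_mono) (simp add: abs_mult r0 mult_left_le)
  have RR: "(\<Sum>i\<in>I. \<Sum>j\<in>I. r i * r j) = R\<^sup>2"
    by (simp add: R_def power2_eq_square sum_product)
  have "?T \<le> (\<Sum>i\<in>I. \<Sum>j\<in>I. r i * r j *
      (2/3 + 7/18 * cos (2 * (\<theta> i - \<theta> j)) - 1/18 * cos (4 * (\<theta> i - \<theta> j))))"
    unfolding P abs_mult using r0
    by (intro sum_mono) (simp only: abs_of_nonneg mult_left_mono[OF abs_cos_le] mult_nonneg_nonneg)
  also have "\<dots> = 2/3 * (\<Sum>i\<in>I. \<Sum>j\<in>I. r i * r j)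
      + 7/18 * (\<Sum>i\<in>I. \<Sum>j\<in>I. r i * r j * cos (2 * (\<theta> i - \<theta> j)))
      - 1/18 * (\<Sum>i\<in>I. \<Sum>j\<in>I. r i * r j * cos (4 * (\<theta> i - \<theta> j)))"
    by (simp add: ring_distribs sum.distrib sum_subtractf sum_distrib_left mult_ac)
  \<comment> \<open>The double sum with factor 4 is a sum of two squares and enters with a negative
    sign, so it is dropped.\<close>
  also have "\<dots> \<le> 2/3 * R\<^sup>2 + 7/18 * (C\<^sup>2 + S\<^sup>2)"
    unfolding sum_sum_mult_cos_diff RR C_def[symmetric] S_def[symmetric]
      diff_le_eq le_add_same_cancel1
    by simp
  finally have T2: "?T \<le> 2/3 * R\<^sup>2 + 7/18 * (C\<^sup>2 + S\<^sup>2)" .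
  have "R\<^sup>2 \<le> (\<Sum>i\<in>I. (r i)\<^sup>2) * (\<Sum>i\<in>I. 1\<^sup>2)"
    using Cauchy_Schwarz_ineq_sum[of r "\<lambda>_. 1" I] by (simp add: R_def)
  then have "R\<^sup>2 \<le> (2 * m)\<^sup>2"
    by (simp add: rr m2 power_mult_distrib)
  then have Rm: "R \<le> 2 * m"
    by (rule power2_le_imp_le) (simp add: m0)
  define V where "V = (\<Sum>i\<in>I. (1 - m * r i)\<^sup>2)"
  have "V = (\<Sum>i\<in>I. 1 - 2 * m * r i + m\<^sup>2 * (r i)\<^sup>2)"
    unfolding V_def by (intro sum.cong) (simp_all add: power2_eq_square algebra_simps)
  also have "\<dots> = real (card I) - 2 * m * R + m\<^sup>2 * 2"
    by (simp add: sum.distrib sum_subtractf R_def rr flip: sum_distrib_left)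
  finally have V: "V = 4 * m\<^sup>2 - 2 * m * R"
    using m2 by simp
  have expand: "(r i * w) * (1 - m * r i) = r i * w - m * ((r i)\<^sup>2 * w)" for i w
    by (simp add: power2_eq_square algebra_simps)
  (* As the r^2-weighted second Fourier coefficient vanishes, r may be replaced by r (1 - m r). *)
  have "C = (\<Sum>i\<in>I. (r i * cos (2 * \<theta> i)) * (1 - m * r i))"
    by (simp only: expand sum_subtractf sum_distrib_left[symmetric] c0 C_def mult_zero_right diff_zero)
  then have C2: "C\<^sup>2 \<le> (\<Sum>i\<in>I. (r i * cos (2 * \<theta> i))\<^sup>2) * V"
    unfolding V_def by (simp only: Cauchy_Schwarz_ineq_sum)
  have "S = (\<Sum>i\<in>I. (r i * sin (2 * \<theta> i)) * (1 - m * r i))"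
    by (simp only: expand sum_subtractf sum_distrib_left[symmetric] s0 S_def mult_zero_right diff_zero)
  then have S2: "S\<^sup>2 \<le> (\<Sum>i\<in>I. (r i * sin (2 * \<theta> i))\<^sup>2) * V"
    unfolding V_def by (simp only: Cauchy_Schwarz_ineq_sum)
  have "(\<Sum>i\<in>I. (r i * cos (2 * \<theta> i))\<^sup>2) + (\<Sum>i\<in>I. (r i * sin (2 * \<theta> i))\<^sup>2) = (\<Sum>i\<in>I. (r i)\<^sup>2)"
    by (simp add: power_mult_distrib flip: sum.distrib distrib_left)
  then have "C\<^sup>2 + S\<^sup>2 \<le> 2 * V"
    using add_mono[OF C2 S2] rr by (simp flip: distrib_right)
  then have CS: "C\<^sup>2 + S\<^sup>2 \<le> 8 * m\<^sup>2 - 4 * m * R"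
    using V by simp
  have T3: "?T \<le> 2/3 * R\<^sup>2 + 7/18 * (8 * m\<^sup>2 - 4 * m * R)"
    by (rule order_trans[OF T2]) (intro add_left_mono mult_left_mono CS, simp)
  \<comment> \<open>The bound \<open>T3\<close> lies below the target by
    \<open>2/9 * (2 * m - R) * (3 * R - m)\<close>, which is nonnegative for \<open>R\<close>
    between \<open>m / 3\<close> and \<open>2 * m\<close>. Small \<open>R\<close> is left to
    \<open>T1\<close>.\<close>
  have "?T \<le> 8/3 * m\<^sup>2"
  proof (cases "R\<^sup>2 \<le> 8/3 * m\<^sup>2")
    case True
    then show ?thesis using T1 by linarith
  next
    case False
    then have "m\<^sup>2 \<le> R\<^sup>2"
      using zero_le_power2[of m] by linarith
    then have "m \<le> R"
      using R0 by (rule power2_le_imp_le)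
    then have "0 \<le> (2 * m - R) * (3 * R - m)"
      using Rm m0 by (intro mult_nonneg_nonneg) auto
    then show ?thesis
      using T3 by (simp add: power2_eq_square algebra_simps)
  qed
  then show ?thesis
    by (simp add: m2)
qed

section \<open>Spectral theorem for real symmetric matrices\<close>

text \<open>A complex eigenvector \<open>z\<close> exists for some eigenvalue \<open>a\<close>.
  Evaluating the symmetric bilinear form of \<open>A\<close> at its real and imaginary parts in both
  orders gives \<open>Im a\<close> times the squared norm of \<open>z\<close> equal to 0. So
  \<open>a\<close> is real, and whichever part of \<open>z\<close> is nonzero is a real
  eigenvector.\<close>

lemma real_symmetric_eigenvector_exists:
  fixes A :: "real mat"
  assumes A: "A \<in> carrier_mat n n" and sym: "transpose_mat A = A" and n: "n > 0"
  shows "\<exists>e v. v \<in> carrier_vec n \<and> v \<noteq> 0\<^sub>v n \<and> A *\<^sub>v v = e \<cdot>\<^sub>v v"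
proof -
  have A_sym: "A $$ (i, j) = A $$ (j, i)" if "i < n" "j < n" for i j
    using arg_cong[OF sym, of "\<lambda>M. M $$ (i, j)"] A that by simp
  define B where "B = map_mat complex_of_real A"
  have B: "B \<in> carrier_mat n n"
    using A by (simp add: B_def)
  obtain as where as: "char_poly B = (\<Prod>a\<leftarrow>as. [:- a, 1:])" "length as = n"
    using char_poly_factorized[OF B] by blast
  then obtain a as' where "as = a # as'"
    using n by (cases as) auto
  then have "poly (char_poly B) a = 0"
    using as by simp
  then have "eigenvalue B a"
    using eigenvalue_root_char_poly[OF B] by simp
  then obtain z where z: "z \<in> carrier_vec n" "z \<noteq> 0\<^sub>v n" "B *\<^sub>v z = a \<cdot>\<^sub>v z"
    using B unfolding eigenvalue_def eigenvector_def by auto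
  have row: "(\<Sum>j<n. complex_of_real (A $$ (i, j)) * z $ j) = a * z $ i" if "i < n" for i
    using arg_cong[OF z(3), of "\<lambda>w. w $ i"] that A z(1)
    by (simp add: B_def scalar_prod_def lessThan_atLeast0)
  define x where "x = vec n (\<lambda>i. Re (z $ i))"
  define y where "y = vec n (\<lambda>i. Im (z $ i))"
  have re: "(\<Sum>j<n. A $$ (i, j) * x $ j) = Re a * x $ i - Im a * y $ i" if "i < n" for i
    using arg_cong[OF row[OF that], of Re] that by (simp add: x_def y_def)
  have im: "(\<Sum>j<n. A $$ (i, j) * y $ j) = Re a * y $ i + Im a * x $ i" if "i < n" for i
    using arg_cong[OF row[OF that], of Im] that by (simp add: x_def y_def)
  have "(\<Sum>i<n. y $ i * (\<Sum>j<n. A $$ (i, j) * x $ j)) = (\<Sum>i<n. \<Sum>j<n. A $$ (i, j) * (y $ i * x $ j))"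
    by (simp add: sum_distrib_left mult_ac)
  also have "\<dots> = (\<Sum>j<n. \<Sum>i<n. A $$ (i, j) * (y $ i * x $ j))"
    by (rule sum.swap)
  also have "\<dots> = (\<Sum>j<n. x $ j * (\<Sum>i<n. A $$ (j, i) * y $ i))"
    by (intro sum.cong refl) (simp add: sum_distrib_left mult_ac A_sym)
  finally have "(\<Sum>i<n. y $ i * (Re a * x $ i - Im a * y $ i)) = (\<Sum>i<n. x $ i * (Re a * y $ i + Im a * x $ i))"
    by (simp add: re im)
  then have "(\<Sum>i<n. Im a * ((x $ i)\<^sup>2 + (y $ i)\<^sup>2)) = 0"
    by (simp add: algebra_simps sum.distrib sum_subtractf power2_eq_square)
  then have "Im a * (\<Sum>i<n. (x $ i)\<^sup>2 + (y $ i)\<^sup>2) = 0"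
    by (simp only: sum_distrib_left)
  moreover have "(\<Sum>i<n. (x $ i)\<^sup>2 + (y $ i)\<^sup>2) \<noteq> 0"
  proof
    assume "(\<Sum>i<n. (x $ i)\<^sup>2 + (y $ i)\<^sup>2) = 0"
    then have "\<forall>i<n. (x $ i)\<^sup>2 + (y $ i)\<^sup>2 = 0"
      by (subst (asm) sum_nonneg_eq_0_iff) auto
    then have "\<forall>i<n. z $ i = 0"
      by (simp add: x_def y_def sum_power2_eq_zero_iff complex_eq_iff)
    then show False
      using z(1,2) by auto
  qed
  ultimately have a0: "Im a = 0"
    by simp
  have Ax: "A *\<^sub>v x = Re a \<cdot>\<^sub>v x" and Ay: "A *\<^sub>v y = Re a \<cdot>\<^sub>v y"
    using A re im a0
    by (auto intro!: eq_vecI simp: x_def y_def scalar_prod_def lessThan_atLeast0)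
  have "x \<noteq> 0\<^sub>v n \<or> y \<noteq> 0\<^sub>v n"
  proof (rule ccontr)
    assume "\<not> ?thesis"
    then have "x $ i = 0 \<and> y $ i = 0" if "i < n" for i
      using that by simp
    then have "z = 0\<^sub>v n"
      using z(1) by (intro eq_vecI) (auto simp: x_def y_def complex_eq_iff)
    then show False
      using z(2) by simp
  qed
  moreover have "x \<in> carrier_vec n" "y \<in> carrier_vec n"
    by (simp_all add: x_def y_def)
  ultimately show ?thesis
    using Ax Ay by blast
qed

text \<open>Gram-Schmidt applied to a basis starting with \<open>v\<close> keeps \<open>v\<close> as
  its first vector; normalising the result gives the columns of \<open>W\<close>, and
  \<open>c\<close> is the factor that normalises \<open>v\<close>.\<close>

lemma orthonormal_completion:
  fixes v :: "real vec"
  assumes v: "v \<in> carrier_vec n" and v0: "v \<noteq> 0\<^sub>v n"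
  shows "\<exists>W c. W \<in> carrier_mat n n \<and> transpose_mat W * W = 1\<^sub>m n \<and> col W 0 = c \<cdot>\<^sub>v v"
proof -
  interpret cof_vec_space n "TYPE(real)" .
  define b where "b = basis_completion v"
  define ws where "ws = gram_schmidt n b"
  note bc = basis_completion[OF v v0, folded b_def]
  obtain vs where bv: "b = v # vs"
    using bc(6,7) v v0 by (cases b) auto
  note gs = gram_schmidt_result[OF bc(2,4,5) refl, folded ws_def]
  have hd: "hd ws = v"
    using gram_schmidt_hd[OF v, of vs] by (simp add: ws_def bv)
  have len: "length ws = n"
    using gs bc by auto
  have n: "n > 0"
    using v v0 by (cases n) auto
  have wsc: "ws ! i \<in> carrier_vec n" if "i < n" for i
    using gs that len by auto
  have orth: "scalar_prod (ws ! i) (ws ! j) = 0 \<longleftrightarrow> i \<noteq> j" if "i < n" "j < n" for i j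
    using gs(2) that len unfolding corthogonal_def by simp
  have pos: "scalar_prod (ws ! i) (ws ! i) > 0" if "i < n" for i
    using orth[OF that that] sum_nonneg[of "{0..<n}" "\<lambda>j. ws ! i $ j * ws ! i $ j"] wsc[OF that]
    by (simp add: scalar_prod_def less_le)
  define c where "c i = 1 / sqrt (scalar_prod (ws ! i) (ws ! i))" for i
  define W where "W = mat_of_cols n (map (\<lambda>i. c i \<cdot>\<^sub>v ws ! i) [0..<n])"
  have W: "W \<in> carrier_mat n n"
    by (simp add: W_def carrier_matI)
  have col: "col W i = c i \<cdot>\<^sub>v ws ! i" if "i < n" for i
    using that wsc[OF that] by (simp add: W_def)
  have "transpose_mat W * W = 1\<^sub>m n"
  proof (rule eq_matI)
    fix i j assume ij: "i < dim_row (1\<^sub>m n)" "j < dim_col (1\<^sub>m n)"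
    then have "(transpose_mat W * W) $$ (i, j) = c i * c j * scalar_prod (ws ! i) (ws ! j)"
      using W wsc[of i] wsc[of j] by (simp add: col)
    also have "\<dots> = 1\<^sub>m n $$ (i, j)"
      using ij orth[of i j] pos[of i] by (auto simp: c_def)
    finally show "(transpose_mat W * W) $$ (i, j) = 1\<^sub>m n $$ (i, j)" .
  qed (use W in auto)
  moreover have "col W 0 = c 0 \<cdot>\<^sub>v v"
    using col[OF n] hd len n by (cases ws) auto
  ultimately show ?thesis
    using W by blast
qed

text \<open>Induction on the dimension. In an orthonormal basis starting with an eigenvector, the
  first column of the matrix is zero below the eigenvalue, and by symmetry so is the first row to
  its right. The remaining block is symmetric and is diagonalised by the induction
  hypothesis.\<close>

lemma real_symmetric_diagonalisation:
  fixes A :: "real mat"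
  assumes "A \<in> carrier_mat n n" and "transpose_mat A = A"
  shows "\<exists>Q D. Q \<in> carrier_mat n n \<and> D \<in> carrier_mat n n \<and> diagonal_mat D \<and>
           transpose_mat Q * Q = 1\<^sub>m n \<and> A * Q = Q * D"
  using assms
proof (induction n arbitrary: A)
  case 0
  then have "A = 1\<^sub>m 0"
    by (intro eq_matI) auto
  then show ?case
    by (intro exI[of _ "1\<^sub>m 0"]) (simp add: diagonal_mat_def)
next
  case (Suc n A)
  note A = Suc.prems(1) and sym = Suc.prems(2)
  obtain e v where v: "v \<in> carrier_vec (Suc n)" "v \<noteq> 0\<^sub>v (Suc n)" "A *\<^sub>v v = e \<cdot>\<^sub>v v"
    using real_symmetric_eigenvector_exists[OF A sym] by auto
  obtain W c where W: "W \<in> carrier_mat (Suc n) (Suc n)" and WW: "transpose_mat W * W = 1\<^sub>m (Suc n)"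
    and colW: "col W 0 = c \<cdot>\<^sub>v v"
    using orthonormal_completion[OF v(1,2)] by blast
  have WT: "transpose_mat W \<in> carrier_mat (Suc n) (Suc n)"
    using W by simp
  have WW': "W * transpose_mat W = 1\<^sub>m (Suc n)"
    using mat_mult_left_right_inverse[OF WT W WW] .
  define A' where "A' = transpose_mat W * (A * W)"
  have A': "A' \<in> carrier_mat (Suc n) (Suc n)"
    using A W by (simp add: A'_def)
  have WA': "W * A' = A * W"
    using assoc_mult_mat[OF W WT mult_carrier_mat[OF A W]] left_mult_one_mat[OF mult_carrier_mat[OF A W]]
    unfolding A'_def WW' by simp
  have A'_sym: "transpose_mat A' = A'"
    unfolding A'_def transpose_mult[OF WT mult_carrier_mat[OF A W]] transpose_mult[OF A W]
    using assoc_mult_mat[OF WT A W] sym by simp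
  have A'_ij: "A' $$ (i, j) = A' $$ (j, i)" if "i < Suc n" "j < Suc n" for i j
    using arg_cong[OF A'_sym, of "\<lambda>M. M $$ (i, j)"] A' that by simp
  have A'_0: "A' $$ (i, 0) = (if i = 0 then e else 0)" if "i < Suc n" for i
  proof -
    have "col (A * W) 0 = A *\<^sub>v col W 0"
      using A W by (auto intro!: eq_vecI)
    also have "\<dots> = e \<cdot>\<^sub>v col W 0"
      using A v by (simp add: colW mult_mat_vec[of _ _ "Suc n"] smult_smult_assoc mult.commute)
    finally have "col (A * W) 0 = e \<cdot>\<^sub>v col W 0" .
    then have "A' $$ (i, 0) = e * (transpose_mat W * W) $$ (i, 0)"
      using A W that by (simp add: A'_def)
    then show ?thesis
      using that by (simp add: WW)
  qed
  have A'_0': "A' $$ (0, i) = (if i = 0 then e else 0)" if "i < Suc n" for i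
    using A'_0[OF that] A'_ij[OF that, of 0] by simp
  define E where "E = mat 1 1 (\<lambda>_. e)"
  define A3 where "A3 = mat n n (\<lambda>(i, j). A' $$ (Suc i, Suc j))"
  have E: "E \<in> carrier_mat 1 1" and A3: "A3 \<in> carrier_mat n n"
    by (simp_all add: E_def A3_def)
  have A'_block: "A' = four_block_mat E (0\<^sub>m 1 n) (0\<^sub>m n 1) A3"
    using A' A'_0 A'_0'
    by (intro eq_matI) (auto simp: E_def A3_def)
  have "transpose_mat A3 = A3"
    using A'_ij by (intro eq_matI) (auto simp: A3_def)
  then obtain Q3 D3 where Q3: "Q3 \<in> carrier_mat n n" and D3: "D3 \<in> carrier_mat n n" "diagonal_mat D3"
    and QQ3: "transpose_mat Q3 * Q3 = 1\<^sub>m n" and AQ3: "A3 * Q3 = Q3 * D3"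
    using Suc.IH[OF A3] by blast
  \<comment> \<open>The orthogonal matrix of the remaining block, extended by the identity on the
    eigenvector; the diagonalising matrix is \<open>W * P\<close>.\<close>
  define P where "P = four_block_mat (1\<^sub>m 1) (0\<^sub>m 1 n) (0\<^sub>m n 1) Q3"
  define D where "D = four_block_mat E (0\<^sub>m 1 n) (0\<^sub>m n 1) D3"
  have P: "P \<in> carrier_mat (Suc n) (Suc n)"
    using four_block_carrier_mat[OF one_carrier_mat[of 1] Q3] by (simp add: P_def)
  have D: "D \<in> carrier_mat (Suc n) (Suc n)"
    using four_block_carrier_mat[OF E D3(1)] by (simp add: D_def)
  have "diagonal_mat D"
    using D3 by (auto simp: D_def E_def diagonal_mat_def)
  have "transpose_mat P = four_block_mat (1\<^sub>m 1) (0\<^sub>m 1 n) (0\<^sub>m n 1) (transpose_mat Q3)"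
    using transpose_four_block_mat[OF one_carrier_mat[of 1] zero_carrier_mat zero_carrier_mat Q3]
    by (simp add: P_def)
  then have "transpose_mat P * P = four_block_mat (1\<^sub>m 1) (0\<^sub>m 1 n) (0\<^sub>m n 1) (1\<^sub>m n)"
    using Q3 QQ3 
    by (simp add: P_def mult_four_block_mat[of _ 1 1 _ n _ n _ _ 1 _ n])
  also have "\<dots> = 1\<^sub>m (Suc n)"
    by (auto intro!: eq_matI)
  finally have PP: "transpose_mat P * P = 1\<^sub>m (Suc n)" .
  have AP: "A' * P = P * D"
    using E A3 Q3 D3 AQ3
    by (simp add: A'_block P_def D_def mult_four_block_mat[of _ 1 1 _ n _ n _ _ 1 _ n])
  have "transpose_mat (W * P) * (W * P) = transpose_mat P * (transpose_mat W * W * P)"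
    using P WT W by (simp add: transpose_mult[OF W P] assoc_mult_mat[OF _ WT mult_carrier_mat[OF W P]]
        assoc_mult_mat[OF WT W P])
  also have "\<dots> = 1\<^sub>m (Suc n)"
    using P by (simp add: WW PP)
  finally have QQ: "transpose_mat (W * P) * (W * P) = 1\<^sub>m (Suc n)" .
  have "A * (W * P) = W * A' * P"
    by (simp add: WA' assoc_mult_mat[OF A W P])
  also have "\<dots> = W * P * D"
    by (simp add: AP assoc_mult_mat[OF W A' P] assoc_mult_mat[OF W P D])
  finally have "A * (W * P) = W * P * D" .
  then show ?case
    using QQ D \<open>diagonal_mat D\<close> W P by (intro exI[of _ "W * P"] exI[of _ D]) simp
qed

section \<open>Eigenvalue lists and ordered orthonormal eigenbases\<close>

lemma order_prod_linear_factors: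
  fixes as :: "'a :: idom list"
  shows "Polynomial.order x (\<Prod>a\<leftarrow>as. [:- a, 1:]) = count (mset as) x"
proof (induction as)
  case Nil
  have "Polynomial.order x (1 :: 'a poly) = 0"
    by (rule order_0I) simp
  then show ?case
    by simp
next
  case (Cons a as)
  have "(\<Prod>a\<leftarrow>a # as. [:- a, 1:]) \<noteq> 0"
    unfolding prod_list_zero_iff by auto
  then have "[:- a, 1:] * (\<Prod>a\<leftarrow>as. [:- a, 1:]) \<noteq> 0"
    by (simp only: list.map prod_list.Cons not_False_eq_True)
  then show ?case
    using Cons by (simp add: Polynomial.order_mult order_linear' del: mult_pCons_left)
qed

text \<open>For a split characteristic polynomial the orders of the roots are the counts of an
  actual multiset, so the \<open>Abs_multiset\<close> in \<open>eig_mset\<close> can be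
  resolved.\<close>

lemma eig_list_eq_rev_sort:
  assumes "char_poly A = (\<Prod>a\<leftarrow>as. [:- a, 1:])"
  shows "eig_list A = rev (sort as)"
proof -
  have "eig_mset A = mset as"
    unfolding eig_mset_def assms order_prod_linear_factors by (rule count_inverse)
  then show ?thesis
    by (simp add: eig_list_def)
qed

text \<open>The form in which the spectral theorem is used below. Indices of \<open>d\<close> start
  at 0 and increase with the eigenvalue, whereas \<open>lam\<close> counts from the largest, so
  \<open>lam (n - 1)\<close> is \<open>d 1\<close>. Completeness is expressed by the absence of
  nonzero vectors orthogonal to all \<open>q i\<close>.\<close>

lemma lam_orthonormal_eigenbasis:
  fixes A :: "real mat"
  assumes A: "A \<in> carrier_mat n n" and sym: "transpose_mat A = A"
  obtains q d where "\<And>i. i < n \<Longrightarrow> q i \<in> carrier_vec n"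
    and "\<And>i. i < n \<Longrightarrow> A *\<^sub>v q i = d i \<cdot>\<^sub>v q i"
    and "\<And>i j. i < n \<Longrightarrow> j < n \<Longrightarrow> scalar_prod (q i) (q j) = (if i = j then 1 else 0)"
    and "\<And>z. z \<in> carrier_vec n \<Longrightarrow> (\<And>i. i < n \<Longrightarrow> scalar_prod (q i) z = 0) \<Longrightarrow> z = 0\<^sub>v n"
    and "\<And>i j. i \<le> j \<Longrightarrow> j < n \<Longrightarrow> d i \<le> d j"
    and "\<And>k. 1 \<le> k \<Longrightarrow> k \<le> n \<Longrightarrow> lam k A = d (n - k)"
proof -
  obtain Q D where Q: "Q \<in> carrier_mat n n" and D: "D \<in> carrier_mat n n" "diagonal_mat D"
    and QQ: "transpose_mat Q * Q = 1\<^sub>m n" and AQ: "A * Q = Q * D"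
    using real_symmetric_diagonalisation[OF assms] by blast
  have QT: "transpose_mat Q \<in> carrier_mat n n"
    using Q by simp
  have QQ': "Q * transpose_mat Q = 1\<^sub>m n"
    using mat_mult_left_right_inverse[OF QT Q QQ] .
  have "A = A * (Q * transpose_mat Q)"
    using A by (simp add: QQ')
  also have "\<dots> = Q * D * transpose_mat Q"
    using A Q QT by (simp add: AQ assoc_mult_mat[symmetric, of _ n n _ n _ n])
  finally have "similar_mat A D"
    unfolding similar_mat_def
    by (intro exI[of _ Q] exI[of _ "transpose_mat Q"] similar_mat_witI[of _ _ n])
      (use A Q D QQ QQ' in auto)
  then have "char_poly A = char_poly D"
    by (rule char_poly_similar)
  also have "\<dots> = (\<Prod>a\<leftarrow>diag_mat D. [:- a, 1:])"
    using D by (intro char_poly_upper_triangular[of _ n]) (auto simp: diagonal_mat_def)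
  finally have eig: "eig_list A = rev (sort (diag_mat D))"
    by (rule eig_list_eq_rev_sort)
  have len: "length (diag_mat D) = n"
    using D by (simp add: diag_mat_def)
  define d where "d i = sort (diag_mat D) ! i" for i
  have "sort (diag_mat D) <~~> diag_mat D"
    by simp
  \<comment> \<open>The permutation \<open>f\<close> that sorts the diagonal of \<open>D\<close> is
    also applied to the columns of \<open>Q\<close>.\<close>
  from permutation_Ex_bij[OF this] obtain f where f: "bij_betw f {..<n} {..<n}"
    and df: "\<And>i. i < n \<Longrightarrow> d i = diag_mat D ! f i"
    by (auto simp: len d_def)
  have fn: "f i < n" if "i < n" for i
    using bij_betwE[OF f] that by auto
  define q where "q i = col Q (f i)" for i
  show thesis
  proof (rule that[of q d])
    show "q i \<in> carrier_vec n" if "i < n" for i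
      using Q col_dim[of Q "f i"] by (simp add: q_def)
    show "A *\<^sub>v q i = d i \<cdot>\<^sub>v q i" if "i < n" for i
    proof -
      have "A *\<^sub>v q i = col (A * Q) (f i)"
        using A Q fn[OF that] by (auto intro!: eq_vecI simp: q_def)
      also have "\<dots> = Q *\<^sub>v col D (f i)"
        using Q D fn[OF that] unfolding AQ by (auto intro!: eq_vecI)
      also have "col D (f i) = d i \<cdot>\<^sub>v unit_vec n (f i)"
        using D fn[OF that] by (auto intro!: eq_vecI simp: diagonal_mat_def df[OF that] diag_mat_def)
      also have "Q *\<^sub>v (d i \<cdot>\<^sub>v unit_vec n (f i)) = d i \<cdot>\<^sub>v q i"
        using Q fn[OF that] by (auto intro!: eq_vecI simp: mult_mat_vec[of _ n n] q_def)
      finally show ?thesis .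
    qed
    show "scalar_prod (q i) (q j) = (if i = j then 1 else 0)" if "i < n" "j < n" for i j
    proof -
      have "scalar_prod (q i) (q j) = (transpose_mat Q * Q) $$ (f i, f j)"
        using Q fn that by (simp add: q_def)
      then show ?thesis
        using inj_on_eq_iff[OF bij_betw_imp_inj_on[OF f]] fn that by (simp add: QQ)
    qed
    show "z = 0\<^sub>v n" if z: "z \<in> carrier_vec n" and 0: "\<And>i. i < n \<Longrightarrow> scalar_prod (q i) z = 0" for z
    proof -
      have "transpose_mat Q *\<^sub>v z = 0\<^sub>v n"
      proof (rule eq_vecI)
        fix j assume j: "j < dim_vec (0\<^sub>v n)"
        then obtain i where "i < n" "j = f i"
          using f by (auto simp: bij_betw_def)
        then show "(transpose_mat Q *\<^sub>v z) $ j = 0\<^sub>v n $ j"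
          using 0[of i] j Q by (simp add: q_def)
      qed (use Q in simp)
      then have "Q *\<^sub>v (transpose_mat Q *\<^sub>v z) = 0\<^sub>v n"
        using Q by (auto intro!: eq_vecI)
      then show ?thesis
        using Q QT z by (simp add: assoc_mult_mat_vec[symmetric, of _ n n _ n] QQ')
    qed
    show "d i \<le> d j" if "i \<le> j" "j < n" for i j
      using that by (simp add: d_def sorted_nth_mono len)
    show "lam k A = d (n - k)" if "1 \<le> k" "k \<le> n" for k
      using that by (simp add: lam_def eig d_def rev_nth len)
  qed
qed

section \<open>Lower and upper bounds for the second smallest eigenvalue\<close>

text \<open>The second smallest eigenvalue is at least the mean of the two smallest, and their sum
  \<open>d 0 + d 1\<close> is the trace of \<open>A\<close> times the projection
  \<open>P\<close>.\<close>

lemma lam_second_smallest_ge: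
  assumes n: "n \<ge> 2" and AS: "A \<in> S_set n"
  shows "lam (n - 1) A \<ge> - real n / 3"
proof -
  have A: "A \<in> carrier_mat n n" and sym: "transpose_mat A = A"
    and A01: "\<And>i j. i < n \<Longrightarrow> j < n \<Longrightarrow> 0 \<le> A $$ (i, j) \<and> A $$ (i, j) \<le> 1"
    using AS by (auto simp: S_set_def)
  obtain q d where q: "\<And>i. i < n \<Longrightarrow> q i \<in> carrier_vec n"
    and Aq: "\<And>i. i < n \<Longrightarrow> A *\<^sub>v q i = d i \<cdot>\<^sub>v q i"
    and orth: "\<And>i j. i < n \<Longrightarrow> j < n \<Longrightarrow> scalar_prod (q i) (q j) = (if i = j then 1 else 0)"
    and "\<And>z. z \<in> carrier_vec n \<Longrightarrow> (\<And>i. i < n \<Longrightarrow> scalar_prod (q i) z = 0) \<Longrightarrow> z = 0\<^sub>v n"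
    and d: "\<And>i j. i \<le> j \<Longrightarrow> j < n \<Longrightarrow> d i \<le> d j"
    and lam: "\<And>k. 1 \<le> k \<Longrightarrow> k \<le> n \<Longrightarrow> lam k A = d (n - k)"
    using lam_orthonormal_eigenbasis[OF A sym] by blast
  have sp: "(\<Sum>i<n. q k $ i * q l $ i) = (if k = l then 1 else 0)" if "k < n" "l < n" for k l
    using orth[OF that] q[OF that(2)] by (simp add: scalar_prod_def lessThan_atLeast0)
  have form: "(\<Sum>i<n. \<Sum>j<n. A $$ (i, j) * (q k $ i * q k $ j)) = d k" if k: "k < n" for k
  proof -
    have "(\<Sum>j<n. A $$ (i, j) * (q k $ i * q k $ j)) = d k * (q k $ i * q k $ i)" if i: "i < n" for i
    proof -
      have "(\<Sum>j<n. A $$ (i, j) * q k $ j) = d k * q k $ i"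
        using arg_cong[OF Aq[OF k], of "\<lambda>v. v $ i"] A q[OF k] i
        by (simp add: scalar_prod_def lessThan_atLeast0)
      then have "q k $ i * (\<Sum>j<n. A $$ (i, j) * q k $ j) = q k $ i * (d k * q k $ i)"
        by simp
      then show ?thesis
        by (simp add: sum_distrib_left mult_ac)
    qed
    then have "(\<Sum>i<n. \<Sum>j<n. A $$ (i, j) * (q k $ i * q k $ j)) = (\<Sum>i<n. d k * (q k $ i * q k $ i))"
      by (intro sum.cong) auto
    then show ?thesis
      using sp[OF k k] by (simp flip: sum_distrib_left)
  qed
  define P where "P i j = q 0 $ i * q 0 $ j + q 1 $ i * q 1 $ j" for i j
  \<comment> \<open>An entry in \<open>[0,1]\<close> makes the product smallest when it is 1 for
    negative \<open>P i j\<close> and 0 otherwise; the left side is the minimum of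
    \<open>P i j\<close> and 0.\<close>
  have "(P i j - \<bar>P i j\<bar>) / 2 \<le> A $$ (i, j) * P i j" if "i < n" "j < n" for i j
    using A01[OF that] mult_right_mono_neg[of "A $$ (i, j)" 1 "P i j"]
    by (cases "P i j \<ge> 0") auto
  then have "(\<Sum>i<n. \<Sum>j<n. (P i j - \<bar>P i j\<bar>) / 2) \<le> (\<Sum>i<n. \<Sum>j<n. A $$ (i, j) * P i j)"
    by (intro sum_mono) auto
  also have "\<dots> = d 0 + d 1"
    using form[of 0] form[of 1] n by (simp add: P_def distrib_left sum.distrib)
  finally have "(\<Sum>i<n. \<Sum>j<n. P i j) - (\<Sum>i<n. \<Sum>j<n. \<bar>P i j\<bar>) \<le> 2 * (d 0 + d 1)"
    by (simp add: sum_subtractf flip: sum_divide_distrib)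
  moreover have "(\<Sum>i<n. \<Sum>j<n. P i j) = (\<Sum>i<n. q 0 $ i)\<^sup>2 + (\<Sum>i<n. q 1 $ i)\<^sup>2"
    by (simp add: P_def sum.distrib power2_eq_square sum_product)
  moreover have "(\<Sum>i<n. \<Sum>j<n. \<bar>P i j\<bar>) \<le> 4/3 * real n"
    using sum_abs_rank_two_projection_le[where I = "{..<n}" and x = "\<lambda>i. q 0 $ i" and y = "\<lambda>i. q 1 $ i"]
      sp[of 0 0] sp[of 1 1] sp[of 0 1] n
    by (simp add: P_def power2_eq_square)
  ultimately have "- (4/3 * real n) \<le> 2 * (d 0 + d 1)"
    using zero_le_power2[of "\<Sum>i<n. q 0 $ i"] zero_le_power2[of "\<Sum>i<n. q 1 $ i"] by linarith
  moreover have "d 0 \<le> d 1" "lam (n - 1) A = d 1"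
    using d[of 0 1] lam[of "n - 1"] n by auto
  ultimately show ?thesis
    by simp
qed

text \<open>Otherwise all eigenvalues except possibly \<open>d 0\<close> exceed \<open>c\<close>, so
  the eigenspace of \<open>c\<close> is orthogonal to \<open>q 1\<close>, ...,
  \<open>q (n - 1)\<close>. It then has dimension at most 1 and cannot contain two independent
  vectors.\<close>

lemma lam_second_smallest_le:
  fixes A :: "real mat"
  assumes n: "n \<ge> 2" and A: "A \<in> carrier_mat n n" and sym: "transpose_mat A = A"
    and u: "u \<in> carrier_vec n" "A *\<^sub>v u = c \<cdot>\<^sub>v u"
    and w: "w \<in> carrier_vec n" "A *\<^sub>v w = c \<cdot>\<^sub>v w"
    and indep: "\<And>a b. a \<cdot>\<^sub>v u + b \<cdot>\<^sub>v w = 0\<^sub>v n \<Longrightarrow> a = 0 \<and> b = 0"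
  shows "lam (n - 1) A \<le> c"
proof (rule ccontr)
  assume neg: "\<not> ?thesis"
  obtain q d where q: "\<And>i. i < n \<Longrightarrow> q i \<in> carrier_vec n"
    and Aq: "\<And>i. i < n \<Longrightarrow> A *\<^sub>v q i = d i \<cdot>\<^sub>v q i"
    and "\<And>i j. i < n \<Longrightarrow> j < n \<Longrightarrow> scalar_prod (q i) (q j) = (if i = j then 1 else 0)"
    and complete: "\<And>z. z \<in> carrier_vec n \<Longrightarrow> (\<And>i. i < n \<Longrightarrow> scalar_prod (q i) z = 0) \<Longrightarrow> z = 0\<^sub>v n"
    and d: "\<And>i j. i \<le> j \<Longrightarrow> j < n \<Longrightarrow> d i \<le> d j"
    and lam: "\<And>k. 1 \<le> k \<Longrightarrow> k \<le> n \<Longrightarrow> lam k A = d (n - k)"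
    using lam_orthonormal_eigenbasis[OF A sym] by blast
  have dc: "d i > c" if "1 \<le> i" "i < n" for i
    using neg lam[of "n - 1"] d[OF that] n by simp
  have orth: "scalar_prod (q i) z = 0" if i: "1 \<le> i" "i < n" and z: "z \<in> carrier_vec n" "A *\<^sub>v z = c \<cdot>\<^sub>v z" for i z
  proof -
    have "c * scalar_prod (q i) z = scalar_prod (q i) (A *\<^sub>v z)"
      using q[OF i(2)] z by simp
    also have "\<dots> = scalar_prod (transpose_mat A *\<^sub>v q i) z"
      using transpose_vec_mult_scalar[OF A z(1) q[OF i(2)]] by simp
    also have "\<dots> = d i * scalar_prod (q i) z"
      using q[OF i(2)] z by (simp add: sym Aq[OF i(2)])
    finally show ?thesis
      using dc[OF i] by simp
  qed
  have q0: "q 0 \<in> carrier_vec n"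
    using q n by simp
  (* A vector of the c-eigenspace orthogonal to q 0 is orthogonal to the whole eigenbasis. *)
  have vanish: "a \<cdot>\<^sub>v u + b \<cdot>\<^sub>v w = 0\<^sub>v n"
    if "a * scalar_prod (q 0) u + b * scalar_prod (q 0) w = 0" for a b
  proof (rule complete)
    show z: "a \<cdot>\<^sub>v u + b \<cdot>\<^sub>v w \<in> carrier_vec n"
      using u w by simp
    show "scalar_prod (q i) (a \<cdot>\<^sub>v u + b \<cdot>\<^sub>v w) = 0" if i: "i < n" for i
    proof -
      have "scalar_prod (q i) (a \<cdot>\<^sub>v u + b \<cdot>\<^sub>v w) = a * scalar_prod (q i) u + b * scalar_prod (q i) w"
        using u(1) w(1) q[OF i] by (simp add: scalar_prod_add_distrib[of _ n])
      then show ?thesis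
        using that orth[OF _ i u] orth[OF _ i w] \<open>a * _ + b * _ = 0\<close> by (cases "i = 0") auto
    qed
  qed
  \<comment> \<open>The combination with these coefficients has no component along
    \<open>q 0\<close>, so it vanishes and independence kills the coefficients. Then
    \<open>u\<close> itself is orthogonal to \<open>q 0\<close> and vanishes, again contradicting
    independence.\<close>
  have "scalar_prod (q 0) u = 0" "scalar_prod (q 0) w = 0"
    using indep[OF vanish[of "scalar_prod (q 0) w" "- scalar_prod (q 0) u"]] by auto
  then have "(1::real) = 0"
    using indep[OF vanish[of 1 0]] by simp
  then show False
    by simp
qed

section \<open>The balanced complete tripartite graph as a multiplication of
  \<open>T11\<close>\<close>

text \<open>The three weights \<open>k\<close> sit on a triangle of \<open>T11\<close>. The last
  vertex is isolated and takes the \<open>r\<close> vertices left over.\<close>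

abbreviation tripartite_weights :: "nat \<Rightarrow> nat \<Rightarrow> nat list" where
  "tripartite_weights k r \<equiv> [k, 0, 0, 0, k, 0, 0, 0, k, 0, r]"

text \<open>Prefix sums grow only at nonzero weights, so the least index whose prefix sum exceeds
  \<open>i\<close> skips the empty blocks.\<close>

lemma block_of_tripartite_weights:
  assumes "i < 3 * k + r"
  shows "block_of (tripartite_weights k r) i =
    (if i < k then 0 else if i < 2 * k then 4 else if i < 3 * k then 8 else 10)"
proof -
  \<comment> \<open>Listing the values below 10 lets \<open>take\<close> be evaluated in each case;
    an index of 10 or more is trivially an upper bound.\<close>
  have small: "y \<in> {0, 1, 2, 3, 4, 5, 6, 7, 8, 9}" if "y < 10" for y :: nat
    using that unfolding insert_iff empty_iff by presburger
  let ?b = "if i < k then 0 else if i < 2 * k then 4 else if i < 3 * k then 8 else (10::nat)"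
  have "?b \<le> y" if y: "i < sum_list (take (Suc y) (tripartite_weights k r))" for y
  proof (cases "y < 10")
    case True
    then show ?thesis
      using small[OF True] y by (auto simp: numeral_eq_Suc split: if_splits)
  qed auto
  moreover have "i < sum_list (take (Suc ?b) (tripartite_weights k r))"
    using assms by (simp add: numeral_eq_Suc)
  ultimately show ?thesis
    unfolding block_of_def by (intro Least_equality)
qed

lemma vertex_mult_tripartite_weights:
  "vertex_mult T11 (tripartite_weights k r) = mat (3 * k + r) (3 * k + r)
     (\<lambda>(i, j). if i < 3 * k \<and> j < 3 * k \<and> i div k \<noteq> j div k then 1 else 0)"
proof -
  have div: "i div k = (if i < k then 0 else if i < 2 * k then 1 else 2)" if "i < 3 * k" for i
    using that by (auto intro!: div_nat_eqI)
  have T11: "T11 $$ (0, 0) = 0" "T11 $$ (0, 4) = 1" "T11 $$ (0, 8) = 1" "T11 $$ (0, 10) = 0"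
    "T11 $$ (4, 0) = 1" "T11 $$ (4, 4) = 0" "T11 $$ (4, 8) = 1" "T11 $$ (4, 10) = 0"
    "T11 $$ (8, 0) = 1" "T11 $$ (8, 4) = 1" "T11 $$ (8, 8) = 0" "T11 $$ (8, 10) = 0"
    "T11 $$ (10, 0) = 0" "T11 $$ (10, 4) = 0" "T11 $$ (10, 8) = 0" "T11 $$ (10, 10) = 0"
    by (simp_all add: T11_def mat_of_rows_list_def)
  have sum: "sum_list (tripartite_weights k r) = 3 * k + r"
    by simp
  show ?thesis
    unfolding vertex_mult_def sum
    by (rule cong_mat) (auto simp: block_of_tripartite_weights div T11)
qed

text \<open>The matrix maps the indicator of a part to \<open>k\<close> times the indicator of the
  other two parts. Hence the difference of the indicators of two parts is an eigenvector for
  \<open>- real k\<close>, and the three parts provide two independent ones.\<close>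

lemma lam_tripartite_le:
  assumes n: "3 * k + r \<ge> 2"
  shows "lam (3 * k + r - 1) (vertex_mult T11 (tripartite_weights k r)) \<le> - real k"
proof -
  let ?n = "3 * k + r"
  define M where "M = vertex_mult T11 (tripartite_weights k r)"
  have M: "M \<in> carrier_mat ?n ?n" and sym: "transpose_mat M = M"
    unfolding M_def vertex_mult_tripartite_weights by (auto intro!: eq_matI)
  show ?thesis
  \<comment> \<open>For \<open>k = 0\<close> the parts are empty and their indicators vanish; the
    matrix is then zero and any two unit vectors serve.\<close>
  proof (cases "k = 0")
    case True
    have M0: "M = 0\<^sub>m ?n ?n"
      unfolding M_def vertex_mult_tripartite_weights using True by (auto intro!: eq_matI)
    have "lam (?n - 1) M \<le> 0"
    proof (rule lam_second_smallest_le[OF n M sym])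
      show "M *\<^sub>v unit_vec ?n 0 = 0 \<cdot>\<^sub>v unit_vec ?n 0" "M *\<^sub>v unit_vec ?n 1 = 0 \<cdot>\<^sub>v unit_vec ?n 1"
        unfolding M0 by (auto intro!: eq_vecI)
      fix a b :: real
      assume "a \<cdot>\<^sub>v unit_vec ?n 0 + b \<cdot>\<^sub>v unit_vec ?n 1 = 0\<^sub>v ?n"
      from arg_cong[OF this, of "\<lambda>v. v $ 0"] arg_cong[OF this, of "\<lambda>v. v $ 1"]
      show "a = 0 \<and> b = 0"
        using n True by simp
    qed simp_all
    then show ?thesis
      using True by (simp add: M_def)
  next
    case False
    define u where "u b = vec ?n (\<lambda>i. of_bool (i < k) - of_bool (b * k \<le> i \<and> i < (b + 1) * k) :: real)" for b
    have "M *\<^sub>v u b = (- real k) \<cdot>\<^sub>v u b" if b: "b = 1 \<or> b = 2" for b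
    proof (rule eq_vecI)
      fix i assume "i < dim_vec ((- real k) \<cdot>\<^sub>v u b)"
      then have i: "i < ?n"
        by (simp add: u_def)
      have div: "j div k = b \<longleftrightarrow> b * k \<le> j \<and> j < (b + 1) * k" for j b :: nat
      proof -
        have "j div k = b \<longleftrightarrow> b \<le> j div k \<and> j div k < b + 1"
          by auto
        then show ?thesis
          using False by (simp only: less_eq_div_iff_mult_less_eq div_less_iff_less_mult)
      qed
      have block: "(\<Sum>j\<in>{0..<?n}. M $$ (i, j) * of_bool (c * k \<le> j \<and> j < (c + 1) * k))
          = of_bool (i < 3 * k \<and> i div k \<noteq> c) * real k" if c: "c \<le> 2" for c
      proof -
        have ck: "(c + 1) * k \<le> 3 * k"
          using mult_le_mono1[of "c + 1" 3 k] c by linarith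
        have "{c * k..<(c + 1) * k} \<subseteq> {0..<?n}"
          using ck by (intro subsetI) (simp only: atLeastLessThan_iff, linarith)
        then have "(\<Sum>j\<in>{0..<?n}. M $$ (i, j) * of_bool (c * k \<le> j \<and> j < (c + 1) * k))
            = (\<Sum>j\<in>{c * k..<(c + 1) * k}. M $$ (i, j))"
          by (intro sum.mono_neutral_cong_right) auto
        also have "\<dots> = (\<Sum>j\<in>{c * k..<(c + 1) * k}. of_bool (i < 3 * k \<and> i div k \<noteq> c))"
        proof (rule sum.cong)
          fix j assume j: "j \<in> {c * k..<(c + 1) * k}"
          then have "j div k = c" "j < 3 * k"
            using ck unfolding div atLeastLessThan_iff by linarith+
          then show "M $$ (i, j) = of_bool (i < 3 * k \<and> i div k \<noteq> c)"
            using i unfolding M_def vertex_mult_tripartite_weights by simp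
        qed simp
        finally show ?thesis
          by simp
      qed
      have "(M *\<^sub>v u b) $ i = (\<Sum>j\<in>{0..<?n}. M $$ (i, j) * (of_bool (j < k) - of_bool (b * k \<le> j \<and> j < (b + 1) * k)))"
        using M i by (simp add: u_def scalar_prod_def)
      also have "\<dots> = of_bool (i < 3 * k \<and> i div k \<noteq> 0) * real k - of_bool (i < 3 * k \<and> i div k \<noteq> b) * real k"
        using block[of 0] block[of b] b by (auto simp: right_diff_distrib sum_subtractf)
      also have "\<dots> = - real k * (of_bool (i < k) - of_bool (b * k \<le> i \<and> i < (b + 1) * k))"
        using b div[of i 0] div[of i b] by auto
      finally show "(M *\<^sub>v u b) $ i = ((- real k) \<cdot>\<^sub>v u b) $ i"
        using i by (simp add: u_def)
    qed (use M in \<open>simp add: u_def\<close>)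
    then have eig: "M *\<^sub>v u 1 = (- real k) \<cdot>\<^sub>v u 1" "M *\<^sub>v u 2 = (- real k) \<cdot>\<^sub>v u 2"
      by blast+
    show ?thesis
      unfolding M_def[symmetric]
    proof (rule lam_second_smallest_le[OF n M sym _ eig(1) _ eig(2)])
      fix a b :: real
      assume "a \<cdot>\<^sub>v u 1 + b \<cdot>\<^sub>v u 2 = 0\<^sub>v ?n"
      \<comment> \<open>Coordinates \<open>k\<close> and \<open>2 * k\<close> are the first ones of
        the second and third part, where the combination takes the values \<open>- a\<close> and
        \<open>- b\<close>.\<close>
      from arg_cong[OF this, of "\<lambda>v. v $ k"] arg_cong[OF this, of "\<lambda>v. v $ (2 * k)"]
      show "a = 0 \<and> b = 0"
        using False by (simp add: u_def)
    qed (simp_all add: u_def)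
  qed
qed

section \<open>Comparison of the two eigenvalue bounds\<close>

theorem theorem4p6:
  fixes n :: nat
  assumes "n \<ge> 2"
    and "\<exists>M. simple_minimiser n M"
  shows "\<exists>xs :: nat list. length xs = 11 \<and> sum_list xs = n \<and>
           (\<forall>S \<in> S_set n. lam (n - 1) (vertex_mult T11 xs) - 2 * sqrt (real n) \<le> lam (n - 1) S)"
proof -
  define k where "k = n div 3"
  define r where "r = n mod 3"
  have n: "n = 3 * k + r" and "r \<le> 2"
    by (auto simp: k_def r_def)
  \<comment> \<open>The bounds \<open>- real n / 3\<close> and \<open>- real k\<close> differ by at
    most 2/3, which \<open>2 * sqrt (real n)\<close> more than covers.\<close>
  then have "real n / 3 \<le> real k + 2/3"
    by simp
  moreover have "1 \<le> sqrt (real n)"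
    using assms(1) by simp
  moreover have "lam (n - 1) (vertex_mult T11 (tripartite_weights k r)) \<le> - real k"
    using lam_tripartite_le[of k r] assms(1) by (simp add: n)
  ultimately have "lam (n - 1) (vertex_mult T11 (tripartite_weights k r)) - 2 * sqrt (real n) \<le> lam (n - 1) S"
    if "S \<in> S_set n" for S
    using lam_second_smallest_ge[OF assms(1) that] by linarith
  then show ?thesis
    by (intro exI[of _ "tripartite_weights k r"]) (simp add: n)
qed

end
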